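(* Let $\pi$ be a permutation of length $n$ of the form $1\,n\cdots 2$ (i.e. $\pi(1)=1$, $\pi(2)=n$, $\pi(n)=2$) such that $\pi$ has no decreasing bond. Then the class $\operatorname{Av}(\pi)$ is not deflatable.
   Context: A permutation $\alpha$ is contained in $\beta$ if $\beta$ has a subsequence in the same relative order as $\alpha$; a class is a set of permutations closed under taking contained permutations; $\operatorname{Av}(\pi)$ is the class of permutations not containing $\pi$. A bond of a permutation is a pair of entries in adjacent positions whose values differ by $1$; it is decreasing if they form the pattern $21$. An interval of a permutation is a set of entries whose positions and values each form a set of consecutive integers, the whole permutation not counting as an interval; a permutation is simple if all its intervals are single entries (so $1$, $12$, $21$ are simple). A class $\mathcal{C}$ is deflatable if there is a proper subclass $\mathcal{D}\subsetneq\mathcal{C}$ with $\mathcal{C}\subseteq\langle\mathcal{D}\rangle$, where the substitution closure $\langle\mathcal{D}\rangle$ is the largest class whose simple permutations are exactly those of $\mathcal{D}$; equivalently, $\mathcal{C}$ is not deflatable if and only if every permutation in $\mathcal{C}$ is contained in some simple permutation belonging to $\mathcal{C}$. *)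

theory Defs
  imports Main "HOL-Library.Sublist" "HOL-Combinatorics.Multiset_Permutations"
begin

text \<open>A permutation of length \<open>n \<ge> 1\<close> is its one-line notation, a list over \<open>{1..n}\<close>;
  the empty permutation is excluded. List positions count from 0, values from 1.\<close>

definition is_perm :: "nat list \<Rightarrow> bool" where
  "is_perm p \<longleftrightarrow> p \<noteq> [] \<and> p \<in> permutations_of_set {1..length p}"

definition order_isomorphic :: "nat list \<Rightarrow> nat list \<Rightarrow> bool" where
  "order_isomorphic xs ys \<longleftrightarrow> length xs = length ys \<and>
     (\<forall>i<length xs. \<forall>j<length xs. xs ! i < xs ! j \<longleftrightarrow> ys ! i < ys ! j)"

definition contained :: "nat list \<Rightarrow> nat list \<Rightarrow> bool" where
  "contained \<alpha> \<beta> \<longleftrightarrow> (\<exists>xs. subseq xs \<beta> \<and> order_isomorphic xs \<alpha>)"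

definition perm_class :: "nat list set \<Rightarrow> bool" where
  "perm_class C \<longleftrightarrow> (\<forall>\<beta>\<in>C. is_perm \<beta>) \<and>
     (\<forall>\<beta>\<in>C. \<forall>\<alpha>. is_perm \<alpha> \<and> contained \<alpha> \<beta> \<longrightarrow> \<alpha> \<in> C)"

definition Av :: "nat list \<Rightarrow> nat list set" where
  "Av \<pi> = {\<sigma>. is_perm \<sigma> \<and> \<not> contained \<pi> \<sigma>}"

text \<open>A bond is given by the position of its left entry.\<close>

definition bond :: "nat list \<Rightarrow> nat \<Rightarrow> bool" where
  "bond p i \<longleftrightarrow> Suc i < length p \<and> (p ! i = Suc (p ! Suc i) \<or> p ! Suc i = Suc (p ! i))"

definition decreasing_bond :: "nat list \<Rightarrow> nat \<Rightarrow> bool" where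
  "decreasing_bond p i \<longleftrightarrow> bond p i \<and> p ! Suc i < p ! i"

definition consecutive :: "nat set \<Rightarrow> bool" where
  "consecutive S \<longleftrightarrow> (\<exists>a b. a \<le> b \<and> S = {a..b})"

text \<open>A set of entries is given by the set \<open>I\<close> of their positions. Intervals are nonempty,
  and the whole permutation does not count as one.\<close>

definition perm_interval :: "nat list \<Rightarrow> nat set \<Rightarrow> bool" where
  "perm_interval p I \<longleftrightarrow> I \<subset> {..<length p} \<and> consecutive I \<and> consecutive ((!) p ` I)"

definition simple_perm :: "nat list \<Rightarrow> bool" where
  "simple_perm p \<longleftrightarrow> is_perm p \<and> (\<forall>I. perm_interval p I \<longrightarrow> card I = 1)"

definition simples :: "nat list set \<Rightarrow> nat list set" where
  "simples C = {\<sigma> \<in> C. simple_perm \<sigma>}"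

definition substitution_closure :: "nat list set \<Rightarrow> nat list set" where
  "substitution_closure D = (GREATEST E. perm_class E \<and> simples E = simples D)"

text \<open>The greatest element exists when \<open>D\<close> is a class.\<close>

lemma
  assumes "perm_class D"
  shows substitution_closure_eq_Union:
      "substitution_closure D = \<Union>{E. perm_class E \<and> simples E = simples D}" (is "_ = ?U")
    and perm_class_substitution_closure: "perm_class (substitution_closure D)"
    and simples_substitution_closure: "simples (substitution_closure D) = simples D"
    and substitution_closure_greatest:
      "\<And>E. perm_class E \<Longrightarrow> simples E = simples D \<Longrightarrow> E \<subseteq> substitution_closure D"
proof -
  have cl: "perm_class ?U"
    unfolding perm_class_def by blast
  have "D \<in> {E. perm_class E \<and> simples E = simples D}"
    using assms by simp
  then have si: "simples ?U = simples D"
    unfolding simples_def by blast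
  show eq: "substitution_closure D = ?U"
    unfolding substitution_closure_def
    by (rule Greatest_equality) (use cl si in auto)
  show "perm_class (substitution_closure D)" "simples (substitution_closure D) = simples D"
    unfolding eq by (fact cl si)+
  show "E \<subseteq> substitution_closure D" if "perm_class E" "simples E = simples D" for E
    unfolding eq using that by blast
qed

definition deflatable :: "nat list set \<Rightarrow> bool" where
  "deflatable C \<longleftrightarrow> (\<exists>D. perm_class D \<and> D \<subset> C \<and> C \<subseteq> substitution_closure D)"

end

theory Submission
  imports Defs Complex_Main
begin

text \<open>It suffices to embed every \<open>\<sigma> \<in> Av \<pi>\<close> into a simple permutation of \<open>Av \<pi>\<close>. Regard
  permutations as finite point sets in the plane. First extend \<open>\<sigma>\<close> to a set \<open>S\<close> that is neither
  a direct nor a skew sum. As long as \<open>S\<close> has a proper interval with at least two points, let \<open>J\<close>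
  be a maximal one and add a point \<open>c\<close> whose column (or row) runs through the inside of \<open>J\<close> and which
  is separated from \<open>J\<close> in the other direction by a point of \<open>S\<close>. Since \<open>S\<close> is indecomposable, no
  proper interval of \<open>S\<close> overlaps the maximal \<open>J\<close>; hence deleting \<open>c\<close> injects the proper intervals
  of \<open>S \<union> {c}\<close> into those of \<open>S\<close> other than \<open>J\<close>, and the process terminates in a simple
  permutation. The point \<open>c\<close> is chosen so that it cannot play any role in an occurrence of \<open>\<pi>\<close>;
  here one uses that \<open>\<pi> = 1 n \<dots> 2\<close>, having no decreasing bond, has length at least 5.\<close>

section \<open>Blocks of a point set\<close>

text \<open>The order comes from an arbitrary coordinate \<open>f\<close>, so that rows and columns
  can be interchanged later.\<close>

definition apart :: "('a \<Rightarrow> real) \<Rightarrow> 'a set \<Rightarrow> 'a set \<Rightarrow> bool" where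
  "apart f A B \<longleftrightarrow> (\<forall>a\<in>A. \<forall>b\<in>B. f a < f b) \<or> (\<forall>a\<in>A. \<forall>b\<in>B. f b < f a)"

lemma apart_iff:
  "apart f A B \<longleftrightarrow> (\<exists>a. \<forall>x\<in>A. \<forall>y\<in>B. (f x < f y) = a \<and> (f y < f x) = (\<not> a))"
proof
  assume "apart f A B"
  then show "\<exists>a. \<forall>x\<in>A. \<forall>y\<in>B. (f x < f y) = a \<and> (f y < f x) = (\<not> a)"
    unfolding apart_def by (elim disjE) (rule exI[of _ True], force, rule exI[of _ False], force)
qed (unfold apart_def, metis)

definition block :: "('a \<Rightarrow> real) \<Rightarrow> ('a \<Rightarrow> real) \<Rightarrow> 'a set \<Rightarrow> 'a set \<Rightarrow> bool" where
  "block f g S J \<longleftrightarrow> J \<subseteq> S \<and> J \<noteq> {} \<and> (\<forall>s\<in>S - J. apart f {s} J \<and> apart g {s} J)"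

definition proper_blocks :: "('a \<Rightarrow> real) \<Rightarrow> ('a \<Rightarrow> real) \<Rightarrow> 'a set \<Rightarrow> 'a set set" where
  "proper_blocks f g S = {J. block f g S J \<and> J \<noteq> S \<and> 2 \<le> card J}"

text \<open>Direct sums are the case where both coordinates put \<open>U\<close> on the same side,
  skew sums the case of opposite sides; one formula excludes both.\<close>

definition indecomposable :: "('a \<Rightarrow> real) \<Rightarrow> ('a \<Rightarrow> real) \<Rightarrow> 'a set \<Rightarrow> bool" where
  "indecomposable f g S \<longleftrightarrow>
     (\<forall>U. U \<subseteq> S \<and> U \<noteq> {} \<and> U \<noteq> S \<longrightarrow> \<not> (apart f U (S - U) \<and> apart g U (S - U)))"

lemma block_commute: "block f g S J \<longleftrightarrow> block g f S J"
  unfolding block_def by blast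

lemma proper_blocks_commute: "proper_blocks f g S = proper_blocks g f S"
  unfolding proper_blocks_def block_commute[of f g] ..

lemma indecomposable_commute: "indecomposable f g S \<longleftrightarrow> indecomposable g f S"
  unfolding indecomposable_def by blast

lemma finite_proper_blocks: "finite S \<Longrightarrow> finite (proper_blocks f g S)"
  by (rule finite_subset[of _ "Pow S"]) (auto simp: proper_blocks_def block_def)

lemma apart_singleton_Un:
  assumes "apart f {s} J" "apart f {s} K" "J \<inter> K \<noteq> {}"
  shows "apart f {s} (J \<union> K)"
proof -
  obtain x where "x \<in> J" "x \<in> K"
    using assms(3) by blast
  then show ?thesis
    using assms(1,2) unfolding apart_def by (metis UnE less_asym singletonD singletonI)
qed

lemma apart_subset: "apart f A B \<Longrightarrow> A' \<subseteq> A \<Longrightarrow> B' \<subseteq> B \<Longrightarrow> apart f A' B'"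
  unfolding apart_def by blast

lemma block_Un:
  assumes "block f g S J" "block f g S K" "J \<inter> K \<noteq> {}"
  shows "block f g S (J \<union> K)"
  using assms apart_singleton_Un[OF _ _ assms(3)] unfolding block_def by auto

text \<open>All of \<open>S - J\<close> lies in \<open>K\<close>, so a point \<open>j\<close> of
  \<open>J\<close> outside \<open>K\<close> sees it on one side. As \<open>J\<close> is a block,
  each point of \<open>S - J\<close> is on the same side of all of \<open>J\<close> as of
  \<open>j\<close>.\<close>

lemma apart_Diff_block:
  assumes "block f g S J" "block f g S K" "J \<union> K = S" "K \<noteq> S"
  shows "apart f (S - J) J"
proof -
  obtain j where j: "j \<in> J" "j \<notin> K"
    using assms by (auto simp: block_def)
  have jK: "apart f {j} K"
    using assms(2,3) j by (auto simp: block_def)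
  have sJ: "apart f {s} J" and sK: "s \<in> K" if "s \<in> S - J" for s
    using assms(1,3) that by (auto simp: block_def)
  have side: "f s < f j \<longleftrightarrow> f t < f j" if "s \<in> S - J" "t \<in> S - J" for s t
    using jK sK[OF that(1)] sK[OF that(2)] unfolding apart_def by fastforce
  have all: "(\<forall>i\<in>J. f s < f i) \<longleftrightarrow> f s < f j" "(\<forall>i\<in>J. f i < f s) \<longleftrightarrow> \<not> f s < f j"
    if "s \<in> S - J" for s
    using sJ[OF that] j(1) unfolding apart_def by fastforce+
  show ?thesis
    unfolding apart_def using all side by meson
qed

lemma indecomposable_Un_blocks:
  assumes "indecomposable f g S" "block f g S J" "block f g S K" "J \<noteq> S" "K \<noteq> S"
  shows "J \<union> K \<noteq> S"
proof
  assume un: "J \<union> K = S"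
  have "apart f (S - J) J" "apart g (S - J) J"
    using apart_Diff_block[of f g S J K] apart_Diff_block[of g f S J K] assms un
    by (auto simp: block_commute[of g f])
  moreover have "S - (S - J) = J" "S - J \<noteq> {}" "S - J \<noteq> S"
    using assms(2,4) by (auto simp: block_def)
  ultimately show False
    using assms(1) unfolding indecomposable_def by (metis Diff_subset)
qed

text \<open>In a sum decomposition the pairs across the two parts are all inversions
  (\<open>b\<close> true, skew sum) or all non-inversions (\<open>b\<close> false, direct
  sum).\<close>

lemma apart_Diff_inversions:
  assumes "apart f U (S - U)" "apart g U (S - U)"
  shows "\<exists>b. \<forall>x\<in>S. \<forall>y\<in>S. (x \<in> U) \<noteq> (y \<in> U) \<longrightarrow> ((f x < f y) \<noteq> (g x < g y)) = b"
proof -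
  from assms(1)[unfolded apart_iff]
  obtain a where a: "\<forall>x\<in>U. \<forall>y\<in>S - U. (f x < f y) = a \<and> (f y < f x) = (\<not> a)" ..
  from assms(2)[unfolded apart_iff]
  obtain a' where a': "\<forall>x\<in>U. \<forall>y\<in>S - U. (g x < g y) = a' \<and> (g y < g x) = (\<not> a')" ..
  have "((f x < f y) \<noteq> (g x < g y)) = (a \<noteq> a')"
    if xy: "x \<in> S" "y \<in> S" "(x \<in> U) \<noteq> (y \<in> U)" for x y
  proof (cases "x \<in> U")
    case True
    then show ?thesis
      using a[rule_format, of x y] a'[rule_format, of x y] xy by simp
  next
    case False
    then show ?thesis
      using a[rule_format, of y x] a'[rule_format, of y x] xy by simp
  qed
  then show ?thesis
    by (intro exI[of _ "a \<noteq> a'"]) simp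
qed

section \<open>Adding a point that cuts a maximal block\<close>

text \<open>The first clause prevents \<open>J\<close> from remaining a block once \<open>c\<close>
  is added; the second, through the separating point \<open>z\<close>, prevents
  \<open>insert c J\<close> from becoming one.\<close>

definition cuts :: "('a \<Rightarrow> real) \<Rightarrow> ('a \<Rightarrow> real) \<Rightarrow> 'a set \<Rightarrow> 'a set \<Rightarrow> 'a \<Rightarrow> bool" where
  "cuts f g S J c \<longleftrightarrow> (\<exists>i\<in>J. \<exists>j\<in>J. f i < f c \<and> f c < f j) \<and>
     (\<exists>z\<in>S - J. (\<forall>j\<in>J. g c < g z \<and> g z < g j) \<or> (\<forall>j\<in>J. g z < g c \<and> g j < g z))"

lemma block_Diff:
  assumes "block f g (insert c S) K" "K \<noteq> {c}" "c \<notin> S"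
  shows "block f g S (K - {c})"
  unfolding block_def
proof (intro conjI ballI)
  show "K - {c} \<subseteq> S" "K - {c} \<noteq> {}"
    using assms by (auto simp: block_def)
  fix s assume "s \<in> S - (K - {c})"
  then have "s \<in> insert c S - K"
    using assms(3) by blast
  then have "apart f {s} K" "apart g {s} K"
    using assms(1) by (simp_all add: block_def)
  then show "apart f {s} (K - {c})" "apart g {s} (K - {c})"
    by (auto elim: apart_subset)
qed

locale block_cut =
  fixes f g :: "'a \<Rightarrow> real" and S J :: "'a set" and c :: 'a
  assumes fin: "finite S" and c: "c \<notin> S"
    and J: "J \<in> proper_blocks f g S"
    and max: "\<And>K. K \<in> proper_blocks f g S \<Longrightarrow> J \<subseteq> K \<Longrightarrow> K = J"
    and indec: "indecomposable f g S"
    and cut: "cuts f g S J c"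
begin

lemma not_apart_new: "\<not> apart f {c} J"
proof -
  obtain i j where "i \<in> J" "j \<in> J" "f i < f c" "f c < f j"
    using cut unfolding cuts_def by blast
  then show ?thesis
    unfolding apart_def by (metis less_asym singletonI)
qed

lemma not_apart_old: "\<not> apart f {c} S"
  using not_apart_new J apart_subset[of f "{c}" S "{c}" J]
  by (auto simp: proper_blocks_def block_def)

text \<open>The union with \<open>J\<close> is a block, and by indecomposability not all of
  \<open>S\<close>. It is therefore proper, and maximality of \<open>J\<close> absorbs
  \<open>K\<close>.\<close>

lemma Un_block:
  assumes "K \<in> proper_blocks f g S" "K \<inter> J \<noteq> {}"
  shows "K \<subseteq> J"
proof -
  have b: "block f g S (J \<union> K)"
    using block_Un[of f g S J K] assms J by (auto simp: proper_blocks_def)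
  have ne: "J \<union> K \<noteq> S"
    using indecomposable_Un_blocks[OF indec] assms J by (auto simp: proper_blocks_def)
  have "finite (J \<union> K)"
    using b fin finite_subset unfolding block_def by blast
  then have "card J \<le> card (J \<union> K)"
    by (simp add: card_mono)
  then have "J \<union> K \<in> proper_blocks f g S"
    using b ne J by (auto simp: proper_blocks_def)
  from max[OF this] show ?thesis
    by blast
qed

text \<open>In the order of \<open>f\<close> the neighbours of \<open>c\<close> lie in \<open>J\<close>, in the order of \<open>g\<close> they do not.\<close>

lemma block_insert_meets:
  assumes K: "block f g (insert c S) K" "c \<in> K" "K \<noteq> {c}"
  shows "K \<inter> J \<noteq> {}" "\<not> K - {c} \<subseteq> J"
proof -
  obtain x where x: "x \<in> K" "x \<noteq> c" "x \<in> S"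
    using K by (auto simp: block_def)
  obtain i j where ij: "i \<in> J" "j \<in> J" "f i < f c" "f c < f j"
    using cut unfolding cuts_def by blast
  obtain z where z: "z \<in> S - J"
    "(\<forall>j\<in>J. g c < g z \<and> g z < g j) \<or> (\<forall>j\<in>J. g z < g c \<and> g j < g z)"
    using cut unfolding cuts_def by blast
  have JS: "J \<subseteq> S" and Jb: "\<And>s. s \<in> S - J \<Longrightarrow> apart f {s} J"
    using J by (auto simp: proper_blocks_def block_def)
  have Kb: "\<And>s. s \<in> S - K \<Longrightarrow> apart f {s} K" "\<And>s. s \<in> S - K \<Longrightarrow> apart g {s} K"
    using K by (auto simp: block_def)
  show "K \<inter> J \<noteq> {}"
  proof
    assume KJ: "K \<inter> J = {}"
    then have "apart f {x} J"
      using Jb x by blast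
    moreover have "apart f {i} K" "apart f {j} K"
      using Kb ij JS KJ by blast+
    ultimately show False
      using ij x K(2) unfolding apart_def by fastforce
  qed
  show "\<not> K - {c} \<subseteq> J"
  proof
    assume KJ: "K - {c} \<subseteq> J"
    then have "apart g {z} K"
      using Kb z c by blast
    then show False
      using z x K(2) KJ unfolding apart_def by fastforce
  qed
qed

text \<open>The values \<open>S\<close> and \<open>J\<close> are excluded because \<open>c\<close>
  lies inside \<open>J\<close> in the order of \<open>f\<close> and is separated from
  \<open>J\<close> in that of \<open>g\<close>. If \<open>c\<close> is in \<open>K\<close>, one
  point of \<open>K\<close> in \<open>J\<close> and another outside it keep the size at least
  2.\<close>

lemma proper_blocks_Diff:
  assumes K: "K \<in> proper_blocks f g (insert c S)"
  shows "K - {c} \<in> proper_blocks f g S - {J}"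
proof -
  have b: "block f g (insert c S) K" "K \<noteq> insert c S" "2 \<le> card K"
    using K by (auto simp: proper_blocks_def)
  have Kc: "K \<noteq> {c}"
    using b by auto
  have b': "block f g S (K - {c})"
    using block_Diff[OF b(1) Kc c] .
  have "K - {c} \<noteq> S"
  proof
    assume eq: "K - {c} = S"
    then have "c \<notin> K"
      using b(2) by blast
    then show False
      using b(1) eq not_apart_old by (auto simp: block_def)
  qed
  moreover have "K - {c} \<noteq> J"
  proof
    assume eq: "K - {c} = J"
    then have "c \<notin> K"
      using block_insert_meets[OF b(1) _ Kc] by blast
    then show False
      using b(1) eq not_apart_new by (auto simp: block_def)
  qed
  moreover have "2 \<le> card (K - {c})"
  proof (cases "c \<in> K")
    case True
    have "finite (K - {c})"
      using b' fin finite_subset unfolding block_def by blast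
    moreover obtain x y where "x \<in> K \<inter> J" "y \<in> K - {c}" "y \<notin> J"
      using block_insert_meets[OF b(1) True Kc] by blast
    moreover from this have "x \<noteq> c"
      using J c by (auto simp: proper_blocks_def block_def)
    ultimately show ?thesis
      using card_mono[of "K - {c}" "{x, y}"] by (cases "x = y") auto
  qed (use b in simp)
  ultimately show ?thesis
    using b' by (auto simp: proper_blocks_def)
qed

text \<open>Two blocks with the same image are \<open>K\<close> and \<open>insert c K\<close> for
  some \<open>K\<close> without \<open>c\<close>. Then \<open>K\<close> meets \<open>J\<close>
  without being contained in it, against \<open>Un_block\<close>.\<close>

lemma inj_on_Diff: "inj_on (\<lambda>K. K - {c}) (proper_blocks f g (insert c S))"
proof -
  have False if K: "K \<in> proper_blocks f g (insert c S)" "insert c K \<in> proper_blocks f g (insert c S)"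
    "c \<notin> K" for K
  proof -
    have b: "block f g (insert c S) K" "block f g (insert c S) (insert c K)"
      using K by (auto simp: proper_blocks_def)
    have "insert c K \<noteq> {c}"
      using b(1) K(3) by (auto simp: block_def)
    from block_insert_meets[OF b(2) _ this] have "insert c K \<inter> J \<noteq> {}" "\<not> K \<subseteq> J"
      using K(3) by auto
    moreover have "c \<notin> J"
      using J c by (auto simp: proper_blocks_def block_def)
    moreover have "K \<in> proper_blocks f g S"
      using proper_blocks_Diff[OF K(1)] K(3) by auto
    ultimately show False
      using Un_block[of K] by blast
  qed
  moreover have "K = L \<or> c \<notin> K \<and> L = insert c K \<or> c \<notin> L \<and> K = insert c L"
    if "K - {c} = L - {c}" for K L
    using that by blast
  ultimately show ?thesis
    unfolding inj_on_def by blast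
qed

lemma card_proper_blocks_less:
  "card (proper_blocks f g (insert c S)) < card (proper_blocks f g S)"
proof -
  have "card (proper_blocks f g (insert c S)) \<le> card (proper_blocks f g S - {J})"
    by (rule card_inj_on_le[OF inj_on_Diff]) (use proper_blocks_Diff finite_proper_blocks[OF fin] in auto)
  also have "\<dots> < card (proper_blocks f g S)"
    using J finite_proper_blocks[OF fin] by (meson card_Diff1_less)
  finally show ?thesis .
qed

text \<open>A decomposition restricts to one of \<open>S\<close> unless one part is
  \<open>{c}\<close>, and \<open>c\<close> is not extremal in the order of \<open>f\<close>.\<close>

lemma indecomposable_insert: "indecomposable f g (insert c S)"
  unfolding indecomposable_def
proof (intro allI impI notI)
  fix U
  assume U: "U \<subseteq> insert c S \<and> U \<noteq> {} \<and> U \<noteq> insert c S"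
    and ap: "apart f U (insert c S - U) \<and> apart g U (insert c S - U)"
  have "U - {c} \<noteq> {}"
  proof
    assume "U - {c} = {}"
    then have "U = {c}"
      using U by blast
    then show False
      using ap c not_apart_old by auto
  qed
  moreover have "U - {c} \<noteq> S"
  proof
    assume "U - {c} = S"
    then have "U = S" "insert c S - U = {c}"
      using U c by auto
    then show False
      using ap not_apart_old by (auto simp: apart_def)
  qed
  moreover have "apart f (U - {c}) (S - (U - {c}))" "apart g (U - {c}) (S - (U - {c}))"
    using ap c unfolding apart_def by auto
  ultimately show False
    using indec U unfolding indecomposable_def by (metis Diff_subset_conv Un_commute insert_is_Un)
qed

end

section \<open>Embeddings of a pattern into a point set\<close>

text \<open>The index set \<open>I\<close> allows partial occurrences, in particular of the pattern
  without its entry 1, where \<open>I = {1..<n}\<close>.\<close>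

definition emb :: "nat list \<Rightarrow> nat set \<Rightarrow> (real \<times> real) set \<Rightarrow> (nat \<Rightarrow> real \<times> real) \<Rightarrow> bool" where
  "emb p I S e \<longleftrightarrow> e ` I \<subseteq> S \<and>
     (\<forall>i\<in>I. \<forall>j\<in>I. i < j \<longrightarrow> fst (e i) < fst (e j)) \<and>
     (\<forall>i\<in>I. \<forall>j\<in>I. p ! i < p ! j \<longrightarrow> snd (e i) < snd (e j))"

definition generic :: "(real \<times> real) set \<Rightarrow> bool" where
  "generic S \<longleftrightarrow> finite S \<and> inj_on fst S \<and> inj_on snd S"

definition NE :: "real \<times> real \<Rightarrow> (real \<times> real) set" where
  "NE c = {s. fst c < fst s \<and> snd c < snd s}"

lemma emb_mem: "emb p I S e \<Longrightarrow> i \<in> I \<Longrightarrow> e i \<in> S"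
  and emb_fst: "emb p I S e \<Longrightarrow> i \<in> I \<Longrightarrow> j \<in> I \<Longrightarrow> i < j \<Longrightarrow> fst (e i) < fst (e j)"
  and emb_snd: "emb p I S e \<Longrightarrow> i \<in> I \<Longrightarrow> j \<in> I \<Longrightarrow> p ! i < p ! j \<Longrightarrow> snd (e i) < snd (e j)"
  by (auto simp: emb_def)

lemma emb_eq_iff: "emb p I S e \<Longrightarrow> i \<in> I \<Longrightarrow> j \<in> I \<Longrightarrow> e i = e j \<longleftrightarrow> i = j"
  by (metis emb_fst less_irrefl linorder_neqE_nat)

lemma emb_subset: "emb p I S e \<Longrightarrow> (\<And>i. i \<in> I \<Longrightarrow> e i \<in> T) \<Longrightarrow> emb p I T e"
  by (auto simp: emb_def)

lemma emb_index_subset: "emb p I S e \<Longrightarrow> I' \<subseteq> I \<Longrightarrow> emb p I' S e"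
  unfolding emb_def by blast

lemma generic_insert:
  "generic S \<Longrightarrow> fst c \<notin> fst ` S \<Longrightarrow> snd c \<notin> snd ` S \<Longrightarrow> generic (insert c S)"
  by (auto simp: generic_def inj_on_insert)

section \<open>Free coordinates and extremal points\<close>

lemma ex_below:
  fixes v :: real
  assumes "finite F"
  shows "\<exists>x<v. \<forall>y\<in>F. y < v \<longrightarrow> y < x"
  using assms
proof induction
  case empty
  then show ?case
    by (intro exI[of _ "v - 1"]) auto
next
  case (insert a F)
  then obtain x where x: "x < v" "\<forall>y\<in>F. y < v \<longrightarrow> y < x"
    by blast
  \<comment> \<open>This maximum may be \<open>a\<close> itself, so the witness is taken strictly
    between it and \<open>v\<close>.\<close>
  have "max x (if a < v then a else x) < v"
    using x(1) by simp
  then obtain w where "max x (if a < v then a else x) < w" "w < v"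
    using dense by blast
  then show ?case
    using x by (intro exI[of _ w]) (auto split: if_splits)
qed

lemma ex_above:
  fixes v :: real
  assumes "finite F"
  shows "\<exists>x>v. \<forall>y\<in>F. v < y \<longrightarrow> x < y"
proof -
  obtain x where x: "x < - v" "\<forall>y\<in>uminus ` F. y < - v \<longrightarrow> y < x"
    using ex_below[of "uminus ` F" "- v"] assms by auto
  then show ?thesis
    by (intro exI[of _ "- x"]) force
qed

lemma ex_maximal_value:
  fixes h :: "'a \<Rightarrow> real"
  assumes "finite A" "A \<noteq> {}"
  shows "\<exists>a\<in>A. \<forall>x\<in>A. h x \<le> h a"
proof -
  have "Max (h ` A) \<in> h ` A"
    using assms by (intro Max_in) auto
  then obtain a where "a \<in> A" "h a = Max (h ` A)"
    by auto
  then show ?thesis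
    using assms(1) by (intro bexI[of _ a]) auto
qed

lemma ex_minimal_value:
  fixes h :: "'a \<Rightarrow> real"
  assumes "finite A" "A \<noteq> {}"
  shows "\<exists>a\<in>A. \<forall>x\<in>A. h a \<le> h x"
  using ex_maximal_value[OF assms, of "\<lambda>x. - h x"] by simp

text \<open>Positions count from 0: the entries 1, \<open>n\<close> and 2 of the pattern have the indices 0, 1 and
  \<open>n - 1\<close>.\<close>

locale pattern =
  fixes p :: "nat list" and n :: nat
  assumes n: "5 \<le> n"
    and first: "\<And>i. 0 < i \<Longrightarrow> i < n \<Longrightarrow> p ! 0 < p ! i"
    and top: "\<And>i. i < n \<Longrightarrow> i \<noteq> 1 \<Longrightarrow> p ! i < p ! 1"
    and last: "\<And>i. 0 < i \<Longrightarrow> i < n - 1 \<Longrightarrow> p ! (n - 1) < p ! i"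
begin

definition avoids :: "(real \<times> real) set \<Rightarrow> bool" where
  "avoids S \<longleftrightarrow> (\<nexists>e. emb p {..<n} S e)"

text \<open>The entry 1 comes first and is smallest, so \<open>s\<close> could serve as this entry
  and complete the occurrence.\<close>

lemma avoids_NE:
  assumes "avoids S" "s \<in> S"
  shows "\<not> emb p {1..<n} (S \<inter> NE s) e"
proof
  assume e: "emb p {1..<n} (S \<inter> NE s) e"
  have "emb p {..<n} S (e(0 := s))"
    unfolding emb_def
  proof (intro conjI ballI impI image_subsetI)
    fix i assume "i \<in> {..<n}"
    then show "(e(0 := s)) i \<in> S"
      using emb_mem[OF e, of i] assms(2) by auto
  next
    fix i j assume "i \<in> {..<n}" "j \<in> {..<n}" "i < j"
    then show "fst ((e(0 := s)) i) < fst ((e(0 := s)) j)"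
      using emb_mem[OF e, of j] emb_fst[OF e, of i j] by (auto simp: NE_def)
  next
    fix i j assume ij: "i \<in> {..<n}" "j \<in> {..<n}" "p ! i < p ! j"
    then have "j \<noteq> 0"
      using first[of i] by (metis lessThan_iff less_asym less_irrefl neq0_conv)
    then show "snd ((e(0 := s)) i) < snd ((e(0 := s)) j)"
      using ij emb_mem[OF e, of j] emb_snd[OF e, of i j] by (auto simp: NE_def)
  qed
  then show False
    using assms(1) by (auto simp: avoids_def)
qed

lemma avoids_insertI:
  assumes "avoids S"
    and "\<And>e r. emb p {..<n} (insert c S) e \<Longrightarrow> r < n \<Longrightarrow> e r = c \<Longrightarrow>
      (\<And>i. i < n \<Longrightarrow> i \<noteq> r \<Longrightarrow> e i \<in> S) \<Longrightarrow> False"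
  shows "avoids (insert c S)"
  unfolding avoids_def
proof
  assume "\<exists>e. emb p {..<n} (insert c S) e"
  then obtain e where e: "emb p {..<n} (insert c S) e"
    by blast
  show False
  proof (cases "\<exists>r<n. e r = c")
    case True
    then obtain r where r: "r < n" "e r = c"
      by blast
    have "e i \<in> S" if "i < n" "i \<noteq> r" for i
      using emb_mem[OF e, of i] emb_eq_iff[OF e, of i r] that r by auto
    then show False
      using assms(2) e r by blast
  next
    case False
    then have "emb p {..<n} S e"
      using emb_subset[OF e] emb_mem[OF e] by blast
    then show False
      using assms(1) by (auto simp: avoids_def)
  qed
qed

text \<open>Every other entry of an occurrence is north-east of the entry 1. With no point of
  \<open>S\<close> south-west of it, \<open>c\<close> can only be the entry 1 itself.\<close>

lemma avoids_insert_minimal: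
  assumes S: "avoids S" and SW: "\<And>s. s \<in> S \<Longrightarrow> c \<notin> NE s"
    and NE: "\<And>e. \<not> emb p {1..<n} (S \<inter> NE c) e"
  shows "avoids (insert c S)"
proof (rule avoids_insertI[OF S])
  fix e r
  assume e: "emb p {..<n} (insert c S) e" and r: "r < n" "e r = c"
    and mem: "\<And>i. i < n \<Longrightarrow> i \<noteq> r \<Longrightarrow> e i \<in> S"
  have ne: "e i \<in> NE (e 0)" if "0 < i" "i < n" for i
    using emb_fst[OF e, of 0 i] emb_snd[OF e, of 0 i] first[of i] that by (auto simp: NE_def)
  show False
  proof (cases "r = 0")
    case True
    have "emb p {1..<n} (S \<inter> NE c) e"
      by (rule emb_subset[OF emb_index_subset[OF e]]) (use ne mem True r in auto)
    then show False
      using NE by blast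
  next
    case False
    then show False
      using SW[of "e 0"] mem[of 0] ne[of r] r by auto
  qed
qed

end

section \<open>Cutting a block\<close>

locale pattern_block = pattern +
  fixes S J :: "(real \<times> real) set"
  assumes gen: "generic S" and avoids: "avoids S"
    and J: "J \<in> proper_blocks fst snd S"
begin

lemma fin: "finite S" and finJ: "finite J" and J_subset: "J \<subseteq> S"
  and J_card: "2 \<le> card J" and J_ne: "J \<noteq> {}"
  using J gen by (auto simp: proper_blocks_def block_def generic_def intro: finite_subset)

lemma fst_eq: "s \<in> S \<Longrightarrow> t \<in> S \<Longrightarrow> fst s = fst t \<longleftrightarrow> s = t"
  and snd_eq: "s \<in> S \<Longrightarrow> t \<in> S \<Longrightarrow> snd s = snd t \<longleftrightarrow> s = t"
  using gen by (auto simp: generic_def inj_on_def)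

lemma outside_fst:
  assumes "s \<in> S" "s \<notin> J"
  shows "(\<forall>j\<in>J. fst s < fst j) \<or> (\<forall>j\<in>J. fst j < fst s)"
  using assms J by (auto simp: proper_blocks_def block_def apart_def)

lemma outside_snd:
  assumes "s \<in> S" "s \<notin> J"
  shows "(\<forall>j\<in>J. snd s < snd j) \<or> (\<forall>j\<in>J. snd j < snd s)"
  using assms J by (auto simp: proper_blocks_def block_def apart_def)

text \<open>The column \<open>x\<close> runs immediately left of the last point \<open>u\<close> of
  \<open>J\<close>. It splits \<open>J\<close>, leaving only \<open>u\<close> on its right, and no
  point of \<open>S\<close> has its column from \<open>x\<close> up to that of \<open>u\<close>,
  exclusive.\<close>

lemma ex_last:
  obtains u x where "u \<in> J" "x < fst u" "\<And>s. s \<in> S \<Longrightarrow> fst s < x \<longleftrightarrow> fst s < fst u"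
    "\<And>j. j \<in> J \<Longrightarrow> j \<noteq> u \<Longrightarrow> fst j < x"
proof -
  obtain u where u: "u \<in> J" "\<And>j. j \<in> J \<Longrightarrow> fst j \<le> fst u"
    using ex_maximal_value[OF finJ J_ne, of fst] by blast
  obtain x where x: "x < fst u" "\<And>s. s \<in> S \<Longrightarrow> fst s < fst u \<Longrightarrow> fst s < x"
    using ex_below[of "fst ` S" "fst u"] fin by auto
  show ?thesis
  proof (rule that[of u x])
    show "fst j < x" if "j \<in> J" "j \<noteq> u" for j
      using u that x(2)[of j] J_subset fst_eq[of j u] by fastforce
    show "fst s < x \<longleftrightarrow> fst s < fst u" if "s \<in> S" for s
      using x that by fastforce
  qed (use u x in auto)
qed

lemma ex_top:
  obtains w y where "w \<in> J" "y < snd w" "\<And>s. s \<in> S \<Longrightarrow> snd s < y \<longleftrightarrow> snd s < snd w"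
    "\<And>j. j \<in> J \<Longrightarrow> j \<noteq> w \<Longrightarrow> snd j < y"
proof -
  obtain w where w: "w \<in> J" "\<And>j. j \<in> J \<Longrightarrow> snd j \<le> snd w"
    using ex_maximal_value[OF finJ J_ne, of snd] by blast
  obtain y where y: "y < snd w" "\<And>s. s \<in> S \<Longrightarrow> snd s < snd w \<Longrightarrow> snd s < y"
    using ex_below[of "snd ` S" "snd w"] fin by auto
  show ?thesis
  proof (rule that[of w y])
    show "snd j < y" if "j \<in> J" "j \<noteq> w" for j
      using w that y(2)[of j] J_subset snd_eq[of j w] by fastforce
    show "snd s < y \<longleftrightarrow> snd s < snd w" if "s \<in> S" for s
      using y that by fastforce
  qed (use w y in auto)
qed

lemma ex_other:
  obtains j where "j \<in> J" "j \<noteq> u"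
proof -
  have "\<not> J \<subseteq> {u}"
    using J_card card_mono[of "{u}" J] by auto
  then show ?thesis
    using that by blast
qed

text \<open>The new point is put just below the lowest point \<open>b\<close> among those left of the last point of
  \<open>J\<close>: nothing lies south-west of it, and everything north-east of it is north-east of \<open>b\<close>.\<close>

lemma ex_cut_of_SW:
  assumes "q \<in> S" and "\<And>j. j \<in> J \<Longrightarrow> j \<in> NE q"
  obtains c where "fst c \<notin> fst ` S" "snd c \<notin> snd ` S" "avoids (insert c S)" "cuts fst snd S J c"
proof -
  obtain u x where u: "u \<in> J" "x < fst u" "\<And>s. s \<in> S \<Longrightarrow> fst s < x \<longleftrightarrow> fst s < fst u"
    "\<And>j. j \<in> J \<Longrightarrow> j \<noteq> u \<Longrightarrow> fst j < x"
    using ex_last by blast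
  let ?L = "{s \<in> S. fst s < x}"
  have qL: "q \<in> ?L"
    using assms u by (auto simp: NE_def)
  obtain b where b: "b \<in> ?L" "\<And>s. s \<in> ?L \<Longrightarrow> snd b \<le> snd s"
    using ex_minimal_value[of ?L snd] finite_subset[OF _ fin, of ?L] qL by blast
  obtain y where y: "y < snd b" "\<And>s. s \<in> S \<Longrightarrow> snd s < snd b \<Longrightarrow> snd s < y"
    using ex_below[of "snd ` S" "snd b"] fin by auto
  let ?c = "(x, y)"
  have av: "avoids (insert ?c S)"
  proof (rule avoids_insert_minimal[OF avoids])
    show "?c \<notin> NE s" if "s \<in> S" for s
      using b(2)[of s] that y(1) by (auto simp: NE_def)
    fix e
    have "S \<inter> NE ?c \<subseteq> S \<inter> NE b"
    proof
      fix s assume s: "s \<in> S \<inter> NE ?c"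
      then have "\<not> snd s < snd b" "s \<noteq> b"
        using y(2)[of s] b(1) by (auto simp: NE_def)
      then show "s \<in> S \<inter> NE b"
        using s b(1) snd_eq[of s b] by (auto simp: NE_def)
    qed
    then show "\<not> emb p {1..<n} (S \<inter> NE ?c) e"
      using avoids_NE[OF avoids, of b e] b(1) by (auto simp: emb_def)
  qed
  \<comment> \<open>The point \<open>b\<close> is no higher than \<open>q\<close>, hence below
    \<open>J\<close>; it separates the new point from \<open>J\<close>.\<close>
  have bJ: "snd b < snd j" if "j \<in> J" for j
    using b(2)[OF qL] assms(2)[OF that] by (auto simp: NE_def)
  obtain j where j: "j \<in> J" "j \<noteq> u"
    using ex_other .
  have cut: "cuts fst snd S J ?c"
    unfolding cuts_def
  proof
    show "\<exists>i\<in>J. \<exists>j\<in>J. fst i < fst ?c \<and> fst ?c < fst j"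
      using u(1,2) u(4)[OF j] j(1) by auto
    show "\<exists>z\<in>S - J. (\<forall>j\<in>J. snd ?c < snd z \<and> snd z < snd j) \<or>
       (\<forall>j\<in>J. snd z < snd ?c \<and> snd j < snd z)"
      using b(1) bJ bJ[of b] y(1) by (intro bexI[of _ b]) auto
  qed
  show ?thesis
  proof (rule that[OF _ _ av cut])
    show "fst ?c \<notin> fst ` S"
      using u(2) by (auto dest: u(3))
    show "snd ?c \<notin> snd ` S"
      using y(1) by (auto dest: y(2))
  qed
qed

text \<open>In the next two lemmas nothing lies south-west of \<open>J\<close>, and \<open>z\<close> is the lowest point above \<open>J\<close>.
  If \<open>z\<close> is left of \<open>J\<close>, the new point goes just below the top point \<open>w\<close> of \<open>J\<close> and just left of
  the left neighbour \<open>a\<close> of \<open>J\<close>; it could only be the entry 1 of the pattern, but then all other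
  entries would be north-east of \<open>z\<close> or of \<open>w\<close>.\<close>

lemma ex_cut_of_above_left:
  assumes SW: "\<And>s j. s \<in> S \<Longrightarrow> j \<in> J \<Longrightarrow> s \<notin> J \<Longrightarrow> j \<notin> NE s"
    and z: "z \<in> S" "z \<notin> J" "\<And>j. j \<in> J \<Longrightarrow> snd j < snd z" "\<And>j. j \<in> J \<Longrightarrow> fst z < fst j"
    and z_next: "\<And>s j. s \<in> S \<Longrightarrow> s \<notin> J \<Longrightarrow> j \<in> J \<Longrightarrow> snd j < snd s \<Longrightarrow> snd z \<le> snd s"
  obtains c where "fst c \<notin> fst ` S" "snd c \<notin> snd ` S" "avoids (insert c S)" "cuts snd fst S J c"
proof -
  obtain w y where w: "w \<in> J" "y < snd w" "\<And>s. s \<in> S \<Longrightarrow> snd s < y \<longleftrightarrow> snd s < snd w"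
    "\<And>j. j \<in> J \<Longrightarrow> j \<noteq> w \<Longrightarrow> snd j < y"
    using ex_top by blast
  obtain j where j: "j \<in> J" "j \<noteq> w"
    using ex_other .
  let ?L = "{s \<in> S. fst s < fst j \<and> s \<notin> J}"
  have zL: "z \<in> ?L"
    using z j by auto
  obtain a where a: "a \<in> ?L" "\<And>s. s \<in> ?L \<Longrightarrow> fst s \<le> fst a"
    using ex_maximal_value[of ?L fst] finite_subset[OF _ fin, of ?L] zL by blast
  \<comment> \<open>Being outside \<open>J\<close> and left of \<open>j\<close>, the point
    \<open>a\<close> is left of all of \<open>J\<close>; since it is not south-west of
    \<open>J\<close>, it is above.\<close>
  have aJ: "fst a < fst i" "snd i < snd a" if "i \<in> J" for i
  proof -
    show "fst a < fst i"
      using a(1) outside_fst[of a] j that by fastforce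
    then show "snd i < snd a"
      using SW[of a i] a(1) that outside_snd[of a] by (fastforce simp: NE_def)
  qed
  obtain x where x: "x < fst a" "\<And>s. s \<in> S \<Longrightarrow> fst s < fst a \<Longrightarrow> fst s < x"
    using ex_below[of "fst ` S" "fst a"] fin by auto
  let ?c = "(x, y)"
  \<comment> \<open>A point outside \<open>J\<close> in this quadrant is above \<open>j\<close>,
    hence above \<open>J\<close>, and not left of \<open>a\<close>; if it differs from
    \<open>a\<close>, the choice of \<open>a\<close> puts it right of \<open>J\<close>.\<close>
  have ne: "s = a \<or> s = w \<or> s \<notin> J \<and> (\<forall>i\<in>J. s \<in> NE i)" if s: "s \<in> S" "s \<in> NE ?c" for s
  proof (cases "s \<in> J")
    case True
    then show ?thesis
      using w(4)[of s] s by (auto simp: NE_def)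
  next
    case False
    have "fst s \<ge> fst a" "snd j < snd s"
      using s x(2)[of s] w(4)[OF j] by (force simp: NE_def)+
    then show ?thesis
      using outside_fst[OF s(1) False] outside_snd[OF s(1) False] a False s(1) j fst_eq[of s a]
      by (fastforce simp: NE_def)
  qed
  have av: "avoids (insert ?c S)"
  proof (rule avoids_insert_minimal[OF avoids])
    show "?c \<notin> NE s" if s: "s \<in> S" for s
    proof
      assume "?c \<in> NE s"
      then have "fst s < fst a" "snd s < snd w"
        using x(1) w(2) by (auto simp: NE_def)
      then show False
        using SW[OF s w(1)] aJ(1)[OF w(1)] aJ(1)[of s] by (auto simp: NE_def)
    qed
    fix e
    show "\<not> emb p {1..<n} (S \<inter> NE ?c) e"
    proof
      assume e: "emb p {1..<n} (S \<inter> NE ?c) e"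
      have cases: "e i = a \<or> e i = w \<or> e i \<notin> J \<and> (\<forall>j\<in>J. e i \<in> NE j)" if "i \<in> {1..<n}" for i
        using ne emb_mem[OF e that] by blast
      \<comment> \<open>No available point is below \<open>w\<close>, so \<open>w\<close> would be
        the entry 2, the last one. Then the indices 1 and 2 would both need a point left of
        \<open>w\<close>, and only \<open>a\<close> is there.\<close>
      have ew: "e i \<noteq> w" if i: "i \<in> {1..<n}" for i
      proof
        assume eq: "e i = w"
        have "i = n - 1"
        proof (rule ccontr)
          assume "i \<noteq> n - 1"
          then have "snd (e (n - 1)) < snd w"
            using emb_snd[OF e, of "n - 1" i] last[of i] i eq by auto
          then show False
            using cases[of "n - 1"] n aJ(2)[OF w(1)] w(1) by (force simp: NE_def)
        qed
        then have "fst (e 1) < fst w" "fst (e 2) < fst w"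
          using emb_fst[OF e, of 1 i] emb_fst[OF e, of 2 i] n eq by auto
        then have "e 1 = a" "e 2 = a"
          using cases[of 1] cases[of 2] n w(1) by (auto simp: NE_def)
        then show False
          using emb_eq_iff[OF e, of 1 2] n by auto
      qed
      \<comment> \<open>No available point is left of \<open>a\<close>, so \<open>a\<close> can only
        have index 1.\<close>
      have right: "e i \<notin> J" "e i \<in> NE k" if i: "i \<in> {1..<n}" "i \<noteq> 1 \<or> e 1 \<noteq> a" "k \<in> J" for i k
      proof -
        have "e i \<noteq> a"
        proof
          assume eq: "e i = a"
          then have "i \<noteq> 1"
            using i by auto
          then have "fst (e 1) < fst a"
            using emb_fst[OF e, of 1 i] i eq by auto
          then show False
            using x(2)[of "e 1"] emb_mem[OF e, of 1] n by (auto simp: NE_def)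
        qed
        then show "e i \<notin> J" "e i \<in> NE k"
          using cases[OF i(1)] ew[OF i(1)] i(3) by auto
      qed
      show False
      proof (cases "e 1 = a")
        case True
        have above: "snd z \<le> snd (e i)" if "i \<in> {1..<n}" for i
        proof (cases "i = 1")
          case True
          then show ?thesis
            using \<open>e 1 = a\<close> z_next[of a w] a(1) aJ(2)[OF w(1)] w(1) by auto
        next
          case False
          then show ?thesis
            using z_next[of "e i" w] right[of i w] w(1) that emb_mem[OF e that]
            by (auto simp: NE_def)
        qed
        \<comment> \<open>The point \<open>a\<close> now plays the entry \<open>n\<close>, so the
          others are below it, whereas all used points are at least as high as
          \<open>z\<close>.\<close>
        have "a \<noteq> z"
        proof
          assume "a = z"
          then have "snd (e 2) < snd z"
            using emb_snd[OF e, of 2 1] top[of 2] n True by auto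
          then show False
            using above[of 2] n by auto
        qed
        then have az: "fst z < fst a"
          using a(2)[OF zL] fst_eq[of a z] a(1) z(1) by auto
        have "emb p {1..<n} (S \<inter> NE z) e"
        proof (rule emb_subset[OF e])
          fix i assume i: "i \<in> {1..<n}"
          have "fst z < fst (e i)"
            using az emb_fst[OF e, of 1 i] i True by (cases "i = 1") auto
          moreover from this have "snd (e i) \<noteq> snd z"
            using snd_eq[of "e i" z] emb_mem[OF e i] z(1) by auto
          ultimately show "e i \<in> S \<inter> NE z"
            using above[OF i] emb_mem[OF e i] by (auto simp: NE_def)
        qed
        then show False
          using avoids_NE[OF avoids z(1)] by blast
      next
        case False
        have "emb p {1..<n} (S \<inter> NE w) e"
          by (rule emb_subset[OF e]) (use right False w(1) emb_mem[OF e] in blast)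
        then show False
          using avoids_NE[OF avoids, of w] w(1) J_subset by blast
      qed
    qed
  qed
  have cut: "cuts snd fst S J ?c"
    unfolding cuts_def
  proof
    show "\<exists>i\<in>J. \<exists>j\<in>J. snd i < snd ?c \<and> snd ?c < snd j"
      using w(1,2) w(4)[OF j] j(1) by auto
    show "\<exists>z\<in>S - J. (\<forall>j\<in>J. fst ?c < fst z \<and> fst z < fst j) \<or>
       (\<forall>j\<in>J. fst z < fst ?c \<and> fst j < fst z)"
      using a(1) aJ(1) x(1) by auto
  qed
  show ?thesis
  proof (rule that[OF _ _ av cut])
    show "fst ?c \<notin> fst ` S"
      using x(1) by (auto dest: x(2))
    show "snd ?c \<notin> snd ` S"
      using w(2) by (auto dest: w(3))
  qed
qed

text \<open>If \<open>z\<close> is right of \<open>J\<close>, the new point goes just above \<open>z\<close> and just left of the last point \<open>u\<close> of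
  \<open>J\<close>. If it is an entry other than 1 of the pattern, then the entry 1 is in \<open>J\<close>, so it is the
  entry \<open>n\<close>, but only \<open>u\<close> and \<open>z\<close> are available for the at least three remaining entries.\<close>

lemma ex_cut_of_above_right:
  assumes SW: "\<And>s j. s \<in> S \<Longrightarrow> j \<in> J \<Longrightarrow> s \<notin> J \<Longrightarrow> j \<notin> NE s"
    and z: "z \<in> S" "z \<notin> J" "\<And>j. j \<in> J \<Longrightarrow> snd j < snd z" "\<And>j. j \<in> J \<Longrightarrow> fst j < fst z"
    and z_next: "\<And>s j. s \<in> S \<Longrightarrow> s \<notin> J \<Longrightarrow> j \<in> J \<Longrightarrow> snd j < snd s \<Longrightarrow> snd z \<le> snd s"
  obtains c where "fst c \<notin> fst ` S" "snd c \<notin> snd ` S" "avoids (insert c S)" "cuts fst snd S J c"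
proof -
  obtain u x where u: "u \<in> J" "x < fst u" "\<And>s. s \<in> S \<Longrightarrow> fst s < x \<longleftrightarrow> fst s < fst u"
    "\<And>j. j \<in> J \<Longrightarrow> j \<noteq> u \<Longrightarrow> fst j < x"
    using ex_last by blast
  obtain j where j: "j \<in> J" "j \<noteq> u"
    using ex_other .
  obtain y where y: "snd z < y" "\<And>s. s \<in> S \<Longrightarrow> snd z < snd s \<Longrightarrow> y < snd s"
    using ex_above[of "snd ` S" "snd z"] fin by auto
  let ?c = "(x, y)"
  have Jy: "snd i < y" if "i \<in> J" for i
    using z(3)[OF that] y(1) by simp
  \<comment> \<open>Between the rows of \<open>J\<close> and the row of the new point only
    \<open>z\<close> occurs.\<close>
  have low: "s = z" if "s \<in> S" "s \<notin> J" "i \<in> J" "snd i < snd s" "snd s < y" for s i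
    using z_next[OF that(1-4)] y(2)[OF that(1)] that(5) snd_eq[OF that(1) z(1)] by fastforce
  have av: "avoids (insert ?c S)"
  proof (rule avoids_insertI[OF avoids])
    fix e r
    assume e: "emb p {..<n} (insert ?c S) e" and r: "r < n" "e r = ?c"
      and mem: "\<And>i. i < n \<Longrightarrow> i \<noteq> r \<Longrightarrow> e i \<in> S"
    have ne: "e i \<in> NE (e 0)" if "0 < i" "i < n" for i
      using emb_fst[OF e, of 0 i] emb_snd[OF e, of 0 i] first[of i] that by (auto simp: NE_def)
    show False
    proof (cases "r = 0")
      \<comment> \<open>As the entry 1, the new point can be replaced by \<open>j\<close>, which is
        left of it and below it.\<close>
      case True
      have "emb p {1..<n} (S \<inter> NE j) e"
      proof (rule emb_subset[OF emb_index_subset[OF e]])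
        fix i assume "i \<in> {1..<n}"
        then show "e i \<in> S \<inter> NE j"
          using ne[of i] mem[of i] True r u(4)[OF j] Jy[OF j(1)] by (auto simp: NE_def)
      qed auto
      then show False
        using avoids_NE[OF avoids, of j] j(1) J_subset by blast
    next
      case False
      have c0: "fst (e 0) < x" "snd (e 0) < y" and e0: "e 0 \<in> S"
        using ne[of r] r False mem[of 0] by (auto simp: NE_def)
      \<comment> \<open>Otherwise the entry 1 is left of \<open>J\<close>, hence above it, hence
        equal to \<open>z\<close>; but \<open>z\<close> is right of \<open>J\<close>.\<close>
      have e0J: "e 0 \<in> J"
      proof (rule ccontr)
        assume nJ: "e 0 \<notin> J"
        have left: "\<forall>k\<in>J. fst (e 0) < fst k"
          using outside_fst[OF e0 nJ] c0(1) u(1,2) by fastforce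
        then have "snd j < snd (e 0)"
          using SW[OF e0 j(1) nJ] j(1) outside_snd[OF e0 nJ] by (auto simp: NE_def)
        then have "e 0 = z"
          using low[OF e0 nJ j(1)] c0(2) by blast
        then show False
          using left z(4)[OF j(1)] j(1) by auto
      qed
      show False
      proof (cases "r = 1")
        case True
        have "e i = u \<or> e i = z" if i: "1 < i" "i < n" for i
        proof -
          have right: "x < fst (e i)" and below: "snd (e i) < y"
            using emb_fst[OF e, of 1 i] emb_snd[OF e, of i 1] top[of i] i True r by auto
          have eS: "e i \<in> S" and above: "snd (e 0) < snd (e i)"
            using mem[of i] ne[of i] i True by (auto simp: NE_def)
          show ?thesis
            using u(4)[of "e i"] right low[OF eS _ e0J above below] by fastforce
        qed
        from this[of 2] this[of 3] this[of 4] show False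
          using n emb_eq_iff[OF e, of 2 3] emb_eq_iff[OF e, of 3 4] emb_eq_iff[OF e, of 2 4] by auto
      next
        \<comment> \<open>The entry \<open>n\<close> would lie horizontally between two points of
          \<open>J\<close>, hence in \<open>J\<close>, yet above the new point.\<close>
        case False
        then have e1: "e 1 \<in> S" "fst (e 0) < fst (e 1)" "fst (e 1) < x" "y < snd (e 1)"
          using mem[of 1] n emb_fst[OF e, of 0 1] emb_fst[OF e, of 1 r] emb_snd[OF e, of r 1]
            top[of r] r \<open>r \<noteq> 0\<close> by auto
        then have "e 1 \<in> J"
          using outside_fst[of "e 1"] e0J u(1,2) by fastforce
        then show False
          using Jy[of "e 1"] e1(4) by simp
      qed
    qed
  qed
  have cut: "cuts fst snd S J ?c"
    unfolding cuts_def
  proof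
    show "\<exists>i\<in>J. \<exists>j\<in>J. fst i < fst ?c \<and> fst ?c < fst j"
      using u(1,2) u(4)[OF j] j(1) by auto
    show "\<exists>z\<in>S - J. (\<forall>j\<in>J. snd ?c < snd z \<and> snd z < snd j) \<or>
       (\<forall>j\<in>J. snd z < snd ?c \<and> snd j < snd z)"
      using z y(1) by auto
  qed
  show ?thesis
  proof (rule that[OF _ _ av cut])
    show "fst ?c \<notin> fst ` S"
      using u(2) by (auto dest: u(3))
    show "snd ?c \<notin> snd ` S"
      using y(1) by (auto dest: y(2))
  qed
qed

text \<open>If no point is south-west of all of \<open>J\<close>, a block makes this true for each
  point of \<open>J\<close> separately. Some point is then above \<open>J\<close>: otherwise
  everything outside is south-east of \<open>J\<close>, giving a skew sum. The lowest point above
  \<open>J\<close> decides the case.\<close>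

lemma ex_cut:
  assumes indec: "indecomposable fst snd S"
  obtains c where "fst c \<notin> fst ` S" "snd c \<notin> snd ` S" "avoids (insert c S)"
    "cuts fst snd S J c \<or> cuts snd fst S J c"
proof (cases "\<exists>q\<in>S. \<forall>j\<in>J. j \<in> NE q")
  case True
  then show ?thesis
    using ex_cut_of_SW that by metis
next
  case False
  have SW: "j \<notin> NE s" if "s \<in> S" "j \<in> J" "s \<notin> J" for s j
  proof
    assume "j \<in> NE s"
    then have "\<forall>j\<in>J. j \<in> NE s"
      using outside_fst[OF that(1,3)] outside_snd[OF that(1,3)] that(2) by (fastforce simp: NE_def)
    then show False
      using False that(1) by blast
  qed
  obtain k where k: "k \<in> J"
    using J_ne by blast
  let ?A = "{s \<in> S. s \<notin> J \<and> snd k < snd s}"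
  have "?A \<noteq> {}"
  proof
    assume A: "?A = {}"
    have out: "(\<forall>j\<in>J. snd s < snd j) \<and> (\<forall>j\<in>J. fst j < fst s)" if s: "s \<in> S - J" for s
    proof -
      have "\<forall>j\<in>J. snd s < snd j"
        using A s k outside_snd[of s] by blast
      then show ?thesis
        using SW[of s k] k s outside_fst[of s] by (auto simp: NE_def)
    qed
    have "apart fst J (S - J)" "apart snd J (S - J)"
      using out unfolding apart_def by blast+
    then show False
      using indec J J_ne J_subset unfolding indecomposable_def proper_blocks_def by blast
  qed
  then obtain z where z: "z \<in> S" "z \<notin> J" "snd k < snd z" and z_min: "\<And>s. s \<in> ?A \<Longrightarrow> snd z \<le> snd s"
    using ex_minimal_value[of ?A snd] finite_subset[OF _ fin, of ?A] by blast
  have zJ: "\<And>j. j \<in> J \<Longrightarrow> snd j < snd z"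
    using outside_snd[OF z(1,2)] k z(3) by fastforce
  have z_next: "snd z \<le> snd s" if "s \<in> S" "s \<notin> J" "j \<in> J" "snd j < snd s" for s j
  proof -
    have "snd k < snd s"
      using outside_snd[OF that(1,2)] that(3,4) k by fastforce
    then show ?thesis
      using z_min[of s] that by blast
  qed
  from outside_fst[OF z(1,2)] show ?thesis
  proof
    assume side: "\<forall>j\<in>J. fst z < fst j"
    show ?thesis
      by (rule ex_cut_of_above_left[of z]) (use SW z zJ z_next side in \<open>blast intro: that\<close>)+
  next
    assume side: "\<forall>j\<in>J. fst j < fst z"
    show ?thesis
      by (rule ex_cut_of_above_right[of z]) (use SW z zJ z_next side in \<open>blast intro: that\<close>)+
  qed
qed

end

section \<open>Iterating the cuts\<close>

context pattern
begin

lemma ex_simple_extension: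
  assumes "generic S" "avoids S" "indecomposable fst snd S"
  shows "\<exists>T. S \<subseteq> T \<and> generic T \<and> avoids T \<and> proper_blocks fst snd T = {}"
  using assms
proof (induction "card (proper_blocks fst snd S)" arbitrary: S rule: less_induct)
  case less
  have fin: "finite (proper_blocks fst snd S)"
    using less.prems(1) finite_proper_blocks by (auto simp: generic_def)
  show ?case
  proof (cases "proper_blocks fst snd S = {}")
    case True
    then show ?thesis
      using less.prems by blast
  next
    case False
    obtain J where J: "J \<in> proper_blocks fst snd S"
      and max: "\<And>K. K \<in> proper_blocks fst snd S \<Longrightarrow> J \<subseteq> K \<Longrightarrow> K = J"
      using finite_has_maximal[OF fin False] by metis
    interpret pattern_block p n S J
      by unfold_locales (use less.prems J in auto)
    obtain c where c: "fst c \<notin> fst ` S" "snd c \<notin> snd ` S" "avoids (insert c S)"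
      "cuts fst snd S J c \<or> cuts snd fst S J c"
      using ex_cut[OF less.prems(3)] .
    have cS: "c \<notin> S"
      using c(1) by blast
    have finS: "finite S"
      using less.prems(1) by (auto simp: generic_def)
    have "card (proper_blocks fst snd (insert c S)) < card (proper_blocks fst snd S) \<and>
      indecomposable fst snd (insert c S)"
      using c(4)
    proof
      assume "cuts fst snd S J c"
      then interpret block_cut fst snd S J c
        by unfold_locales (use finS cS J max less.prems in auto)
      show ?thesis
        using card_proper_blocks_less indecomposable_insert by blast
    next
      \<comment> \<open>A row through \<open>J\<close> is a column after exchanging the coordinates,
        which changes neither proper blocks nor indecomposability.\<close>
      assume "cuts snd fst S J c"
      then interpret block_cut snd fst S J c
        by unfold_locales
          (use finS cS J max less.prems in
            \<open>auto simp: proper_blocks_commute[of snd fst] indecomposable_commute[of snd fst]\<close>)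
      show ?thesis
        using card_proper_blocks_less indecomposable_insert
        by (simp add: proper_blocks_commute[of snd fst] indecomposable_commute[of snd fst])
    qed
    then obtain T where "insert c S \<subseteq> T" "generic T" "avoids T" "proper_blocks fst snd T = {}"
      using less.hyps[of "insert c S"] generic_insert[OF less.prems(1) c(1,2)] c(3) by blast
    then show ?thesis
      by blast
  qed
qed

end

section \<open>Permutations as point sets\<close>

text \<open>\<open>diagram s S \<phi>\<close>: the list \<open>s\<close> is the standardization of the point set \<open>S\<close>, read from
  left to right by \<open>\<phi>\<close>.\<close>

definition diagram :: "nat list \<Rightarrow> (real \<times> real) set \<Rightarrow> (nat \<Rightarrow> real \<times> real) \<Rightarrow> bool" where
  "diagram s S \<phi> \<longleftrightarrow> bij_betw \<phi> {..<length s} S \<and>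
     (\<forall>i<length s. \<forall>j<length s. i < j \<longleftrightarrow> fst (\<phi> i) < fst (\<phi> j)) \<and>
     (\<forall>i<length s. \<forall>j<length s. s ! i < s ! j \<longleftrightarrow> snd (\<phi> i) < snd (\<phi> j))"

lemma is_perm_iff: "is_perm s \<longleftrightarrow> s \<noteq> [] \<and> distinct s \<and> set s = {1..length s}"
  by (auto simp: is_perm_def permutations_of_set_def)

text \<open>Conversely, the image of the last index splits \<open>ys\<close>: the earlier letters
  embed in the part before it, the last letter in the rest.\<close>

lemma subseq_iff_index_map:
  "subseq xs ys \<longleftrightarrow> (\<exists>h. (\<forall>i<length xs. h i < length ys \<and> xs ! i = ys ! h i) \<and>
     (\<forall>i<length xs. \<forall>j<length xs. i < j \<longrightarrow> h i < h j))" (is "_ \<longleftrightarrow> (\<exists>h. ?P xs ys h)")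
proof
  assume "subseq xs ys"
  then show "\<exists>h. ?P xs ys h"
  proof (induction rule: list_emb.induct)
    case (list_emb_Nil ys)
    then show ?case
      by simp
  next
    case (list_emb_Cons xs ys y)
    then obtain h where "?P xs ys h"
      by blast
    then show ?case
      by (intro exI[of _ "\<lambda>i. Suc (h i)"]) auto
  next
    case (list_emb_Cons2 x y xs ys)
    then obtain h where "?P xs ys h"
      by blast
    then show ?case
      using list_emb_Cons2 by (intro exI[of _ "case_nat 0 (\<lambda>i. Suc (h i))"])
        (auto simp: nth_Cons less_Suc_eq_0_disj split: nat.splits)
  qed
next
  assume "\<exists>h. ?P xs ys h"
  then obtain h where "?P xs ys h"
    by blast
  then show "subseq xs ys"
  proof (induction xs arbitrary: ys rule: rev_induct)
    case (snoc x xs)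
    let ?k = "h (length xs)"
    have k: "?k < length ys" "x = ys ! ?k"
      using snoc.prems by (auto simp: nth_append dest: spec[of _ "length xs"])
    have "?P xs (take ?k ys) h"
    proof (intro conjI allI impI)
      fix i assume i: "i < length xs"
      then have "h i < ?k" "h i < length ys" "(xs @ [x]) ! i = ys ! h i"
        using snoc.prems by auto
      then show "h i < length (take ?k ys)" "xs ! i = take ?k ys ! h i"
        using i by (auto simp: nth_append)
    qed (use snoc.prems in auto)
    then have "subseq xs (take ?k ys)"
      by (rule snoc.IH)
    moreover have "subseq [x] (drop ?k ys)"
      using k by (simp add: Cons_nth_drop_Suc[symmetric])
    ultimately have "subseq (xs @ [x]) (take ?k ys @ drop ?k ys)"
      by (rule list_emb_append_mono)
    then show ?case
      by simp
  qed simp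
qed

lemma contained_iff_index_map:
  "contained a s \<longleftrightarrow> (\<exists>h. (\<forall>i<length a. h i < length s) \<and>
     (\<forall>i<length a. \<forall>j<length a. i < j \<longrightarrow> h i < h j) \<and>
     (\<forall>i<length a. \<forall>j<length a. s ! h i < s ! h j \<longleftrightarrow> a ! i < a ! j))" (is "_ \<longleftrightarrow> ?R")
proof
  assume "contained a s"
  then obtain xs where "subseq xs s" "order_isomorphic xs a"
    unfolding contained_def by blast
  moreover from this(1) obtain h where
    "\<forall>i<length xs. h i < length s \<and> xs ! i = s ! h i"
    "\<forall>i<length xs. \<forall>j<length xs. i < j \<longrightarrow> h i < h j"
    unfolding subseq_iff_index_map by blast
  ultimately show ?R
    unfolding order_isomorphic_def by (intro exI[of _ h]) auto
next
  assume ?R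
  then obtain h where h: "\<forall>i<length a. h i < length s"
    "\<forall>i<length a. \<forall>j<length a. i < j \<longrightarrow> h i < h j"
    "\<forall>i<length a. \<forall>j<length a. s ! h i < s ! h j \<longleftrightarrow> a ! i < a ! j"
    by blast
  let ?xs = "map (\<lambda>i. s ! h i) [0..<length a]"
  have "subseq ?xs s"
    unfolding subseq_iff_index_map using h(1,2) by (intro exI[of _ h]) auto
  moreover have "order_isomorphic ?xs a"
    unfolding order_isomorphic_def using h(3) by auto
  ultimately show "contained a s"
    unfolding contained_def by blast
qed

text \<open>Index maps and embeddings correspond by composition with \<open>\<phi>\<close> or its
  inverse. Distinctness of \<open>a\<close> turns the implications in \<open>emb\<close> into
  equivalences.\<close>

lemma diagram_contained_iff:
  assumes "diagram s S \<phi>" "distinct a"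
  shows "contained a s \<longleftrightarrow> (\<exists>e. emb a {..<length a} S e)"
proof
  have bij: "bij_betw \<phi> {..<length s} S"
    and f: "\<And>i j. i < length s \<Longrightarrow> j < length s \<Longrightarrow> i < j \<longleftrightarrow> fst (\<phi> i) < fst (\<phi> j)"
    and g: "\<And>i j. i < length s \<Longrightarrow> j < length s \<Longrightarrow> s ! i < s ! j \<longleftrightarrow> snd (\<phi> i) < snd (\<phi> j)"
    using assms(1) by (auto simp: diagram_def)
  {
    assume "contained a s"
    then obtain h where h: "\<forall>i<length a. h i < length s"
      "\<forall>i<length a. \<forall>j<length a. i < j \<longrightarrow> h i < h j"
      "\<forall>i<length a. \<forall>j<length a. s ! h i < s ! h j \<longleftrightarrow> a ! i < a ! j"
      unfolding contained_iff_index_map by blast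
    have "emb a {..<length a} S (\<phi> \<circ> h)"
      unfolding emb_def using h bij_betwE[OF bij] f g by auto
    then show "\<exists>e. emb a {..<length a} S e"
      by blast
  next
    assume "\<exists>e. emb a {..<length a} S e"
    then obtain e where e: "emb a {..<length a} S e"
      by blast
    let ?h = "\<lambda>i. inv_into {..<length s} \<phi> (e i)"
    have h: "?h i < length s" "\<phi> (?h i) = e i" if "i < length a" for i
    proof -
      have "e i \<in> \<phi> ` {..<length s}"
        using emb_mem[OF e, of i] that bij by (auto simp: bij_betw_def)
      from inv_into_into[OF this] f_inv_into_f[OF this]
      show "?h i < length s" "\<phi> (?h i) = e i"
        by simp_all
    qed
    have "s ! ?h i < s ! ?h j \<longleftrightarrow> a ! i < a ! j" if ij: "i < length a" "j < length a" for i j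
    proof -
      have "a ! i < a ! j \<Longrightarrow> snd (e i) < snd (e j)" "a ! j < a ! i \<Longrightarrow> snd (e j) < snd (e i)"
        using emb_snd[OF e] ij by auto
      moreover have "i = j" if "a ! i = a ! j"
        using that ij assms(2) nth_eq_iff_index_eq by blast
      ultimately show ?thesis
        using g[of "?h i" "?h j"] h[OF ij(1)] h[OF ij(2)] by (metis less_asym less_irrefl nat_neq_iff)
    qed
    moreover have "?h i < ?h j" if ij: "i < length a" "j < length a" "i < j" for i j
      using f[of "?h i" "?h j"] h[OF ij(1)] h[OF ij(2)] emb_fst[OF e, of i j] ij by auto
    ultimately show "contained a s"
      unfolding contained_iff_index_map using h(1) by (intro exI[of _ ?h]) blast
  }
qed

lemma diagram_emb: "diagram s S \<phi> \<Longrightarrow> S \<subseteq> T \<Longrightarrow> emb s {..<length s} T \<phi>"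
  unfolding diagram_def emb_def bij_betw_def by auto

definition points :: "nat list \<Rightarrow> (real \<times> real) set" where
  "points s = (\<lambda>i. (real i, real (s ! i))) ` {..<length s}"

lemma diagram_points: "diagram s (points s) (\<lambda>i. (real i, real (s ! i)))"
  by (auto simp: diagram_def points_def bij_betw_def inj_on_def)

lemma generic_points: "distinct s \<Longrightarrow> generic (points s)"
  by (auto simp: generic_def points_def inj_on_def nth_eq_iff_index_eq)

text \<open>Here \<open>\<phi>\<close> lists \<open>S\<close> by first coordinate, and the entries
  are the ranks of the second coordinates. A point counts itself, so the ranks start from 1.\<close>

lemma ex_diagram:
  assumes "generic S" "S \<noteq> {}"
  shows "\<exists>s \<phi>. is_perm s \<and> diagram s S \<phi>"
proof -
  have fin: "finite S" and injf: "inj_on fst S" and injg: "inj_on snd S"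
    using assms(1) by (auto simp: generic_def)
  let ?xs = "sorted_list_of_set (fst ` S)"
  define m where "m = card S"
  define \<phi> where "\<phi> i = inv_into S fst (?xs ! i)" for i
  define rank where "rank q = card {t \<in> S. snd t \<le> snd q}" for q :: "real \<times> real"
  define s where "s = map (rank \<circ> \<phi>) [0..<m]"
  have len: "length ?xs = m" "length s = m"
    using injf by (auto simp: m_def s_def card_image)
  have xs: "set ?xs = fst ` S"
    using fin by simp
  have \<phi>: "\<phi> i \<in> S" "fst (\<phi> i) = ?xs ! i" if "i < m" for i
  proof -
    have "?xs ! i \<in> fst ` S"
      using nth_mem[of i ?xs] that len xs by simp
    from inv_into_into[OF this] f_inv_into_f[OF this]
    show "\<phi> i \<in> S" "fst (\<phi> i) = ?xs ! i"
      by (simp_all add: \<phi>_def)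
  qed
  have f: "i < j \<longleftrightarrow> fst (\<phi> i) < fst (\<phi> j)" if "i < m" "j < m" for i j
  proof -
    have xs_less: "?xs ! k < ?xs ! l" if "k < l" "l < m" for k l
      using sorted_wrt_nth_less[OF strict_sorted_list_of_set[of "fst ` S"] that(1)] that(2) len by simp
    then show ?thesis
      using \<phi>(2)[OF that(1)] \<phi>(2)[OF that(2)] xs_less[of i j] xs_less[of j i] that
      by (cases i j rule: linorder_cases) (auto dest: less_asym)
  qed
  have inj\<phi>: "inj_on \<phi> {..<m}"
  proof (rule inj_onI)
    fix i j assume "i \<in> {..<m}" "j \<in> {..<m}" "\<phi> i = \<phi> j"
    then show "i = j"
      using f[of i j] f[of j i] by auto
  qed
  have im\<phi>: "\<phi> ` {..<m} = S"
  proof (rule card_subset_eq[OF fin])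
    show "\<phi> ` {..<m} \<subseteq> S"
      using \<phi>(1) by blast
    show "card (\<phi> ` {..<m}) = card S"
      using card_image[OF inj\<phi>] by (simp add: m_def)
  qed
  with inj\<phi> have bij: "bij_betw \<phi> {..<length s} S"
    by (simp add: bij_betw_def len)
  have rank_less: "rank q < rank r" if "q \<in> S" "r \<in> S" "snd q < snd r" for q r
  proof -
    have "r \<in> {t \<in> S. snd t \<le> snd r} - {t \<in> S. snd t \<le> snd q}"
      "{t \<in> S. snd t \<le> snd q} \<subseteq> {t \<in> S. snd t \<le> snd r}"
      using that by auto
    then have "{t \<in> S. snd t \<le> snd q} \<subset> {t \<in> S. snd t \<le> snd r}"
      by blast
    then show ?thesis
      unfolding rank_def using fin by (simp add: psubset_card_mono)
  qed
  have rank_iff: "rank q < rank r \<longleftrightarrow> snd q < snd r" if "q \<in> S" "r \<in> S" for q r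
    using rank_less[of q r] rank_less[of r q] inj_onD[OF injg, of q r] that
    by (cases "snd q" "snd r" rule: linorder_cases) auto
  have "s ! i < s ! j \<longleftrightarrow> snd (\<phi> i) < snd (\<phi> j)" if "i < m" "j < m" for i j
    using that rank_iff[OF \<phi>(1)[OF that(1)] \<phi>(1)[OF that(2)]] by (simp add: s_def)
  with bij f have dia: "diagram s S \<phi>"
    unfolding diagram_def len by blast
  have "inj_on rank S"
  proof (rule inj_onI)
    fix q r assume qr: "q \<in> S" "r \<in> S" "rank q = rank r"
    then have "snd q = snd r"
      using rank_iff[OF qr(1,2)] rank_iff[OF qr(2,1)] by linarith
    then show "q = r"
      using inj_onD[OF injg] qr(1,2) by blast
  qed
  then have "inj_on (rank \<circ> \<phi>) {..<m}"
    by (intro comp_inj_on[OF inj\<phi>]) (simp add: im\<phi>)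
  then have dist: "distinct s"
    unfolding s_def distinct_map by (simp add: atLeast0LessThan)
  have rank_mem: "rank q \<in> {1..m}" if "q \<in> S" for q
  proof -
    have "q \<in> {t \<in> S. snd t \<le> snd q}"
      using that by simp
    then have "{t \<in> S. snd t \<le> snd q} \<noteq> {}"
      by blast
    then have "0 < rank q"
      unfolding rank_def using fin by (subst card_gt_0_iff) simp
    moreover have "rank q \<le> m"
      unfolding rank_def m_def using fin by (simp add: card_mono)
    ultimately show ?thesis
      by simp
  qed
  have "set s = rank ` (\<phi> ` {..<m})"
    unfolding s_def by (simp add: image_image atLeast0LessThan)
  moreover have "rank ` S \<subseteq> {1..m}"
    by (rule image_subsetI) (rule rank_mem)
  ultimately have "set s \<subseteq> {1..m}"
    by (simp only: im\<phi>)
  then have "set s = {1..m}"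
    by (rule card_subset_eq[OF finite_atLeastAtMost]) (simp add: distinct_card[OF dist] len)
  moreover have "s \<noteq> []"
    using assms(2) fin len(2) by (metis card_0_eq length_0_conv m_def)
  ultimately have "is_perm s"
    using dist len by (simp add: is_perm_iff)
  with dia show ?thesis
    by (intro exI conjI)
qed

text \<open>Positions and values outside an integer interval lie on one side of it, so
  \<open>\<phi>\<close> maps an interval of \<open>s\<close> to a block.\<close>

lemma diagram_simple:
  assumes s: "is_perm s" and dia: "diagram s S \<phi>" and none: "proper_blocks fst snd S = {}"
  shows "simple_perm s"
  unfolding simple_perm_def
proof (intro conjI allI impI s)
  fix I assume I: "perm_interval s I"
  have bij: "bij_betw \<phi> {..<length s} S"
    and f: "\<And>i j. i < length s \<Longrightarrow> j < length s \<Longrightarrow> i < j \<longleftrightarrow> fst (\<phi> i) < fst (\<phi> j)"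
    and g: "\<And>i j. i < length s \<Longrightarrow> j < length s \<Longrightarrow> s ! i < s ! j \<longleftrightarrow> snd (\<phi> i) < snd (\<phi> j)"
    using dia by (auto simp: diagram_def)
  have sub: "I \<subset> {..<length s}" and "consecutive I" "consecutive ((!) s ` I)"
    using I by (simp_all add: perm_interval_def)
  obtain a b where ab: "a \<le> b" "I = {a..b}"
    using \<open>consecutive I\<close> unfolding consecutive_def by blast
  obtain c d where cd: "(!) s ` I = {c..d}"
    using \<open>consecutive ((!) s ` I)\<close> unfolding consecutive_def by blast
  have inj: "inj_on \<phi> {..<length s}" and im: "\<phi> ` {..<length s} = S"
    using bij by (auto simp: bij_betw_def)
  have "block fst snd S (\<phi> ` I)"
    unfolding block_def
  proof (intro conjI ballI)
    show "\<phi> ` I \<subseteq> S" "\<phi> ` I \<noteq> {}"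
      using im sub ab by auto
    fix q assume "q \<in> S - \<phi> ` I"
    then obtain k where k: "k < length s" "k \<notin> I" "q = \<phi> k"
      using im by auto
    have less: "i < length s" if "i \<in> I" for i
      using sub that by auto
    have val: "s ! i \<in> {c..d}" if "i \<in> I" for i
      unfolding cd[symmetric] using that by (rule imageI)
    have "(\<forall>i\<in>I. k < i) \<or> (\<forall>i\<in>I. i < k)"
      using k(2) ab by auto
    then show "apart fst {q} (\<phi> ` I)"
      unfolding apart_def k(3) using f k(1) less by simp
    have "s ! k \<noteq> s ! i" if "i \<in> I" for i
      using k(1,2) less[OF that] that s by (auto simp: is_perm_iff nth_eq_iff_index_eq)
    then have "s ! k \<notin> {c..d}"
      unfolding cd[symmetric] by blast
    then have "s ! k < c \<or> d < s ! k"
      by auto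
    then have "(\<forall>i\<in>I. s ! k < s ! i) \<or> (\<forall>i\<in>I. s ! i < s ! k)"
      using val by (meson atLeastAtMost_iff le_less_trans less_le_trans)
    then show "apart snd {q} (\<phi> ` I)"
      unfolding apart_def k(3) using g k(1) less by simp
  qed
  moreover have "\<phi> ` I \<noteq> S"
    using inj_on_image_eq_iff[OF inj, of I "{..<length s}"] im sub by auto
  moreover have "card (\<phi> ` I) = card I"
    using inj_on_subset[OF inj] sub by (intro card_image) auto
  ultimately have "\<not> 2 \<le> card I"
    using none by (auto simp: proper_blocks_def)
  then show "card I = 1"
    using ab by auto
qed

section \<open>The class of permutations avoiding the pattern\<close>

context pattern
begin

text \<open>Completing \<open>s\<close> to the inflation \<open>2413[s, 1, 1, 1]\<close> makes it indecomposable.\<close>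

lemma ex_indecomposable_extension:
  assumes s: "is_perm s" and av: "avoids (points s)"
  shows "\<exists>T. points s \<subseteq> T \<and> generic T \<and> avoids T \<and> indecomposable fst snd T"
proof -
  let ?P = "points s"
  define m where "m = real (length s)"
  \<comment> \<open>In 2413, \<open>s\<close> takes the place of 2, and \<open>?t\<close>,
    \<open>?d\<close>, \<open>?r\<close> are the entries 4, 1, 3. Positions of \<open>s\<close> end
    at \<open>m - 1\<close> and values start from 1, so column \<open>m\<close> and row 0 are
    free.\<close>
  let ?d = "(m + 1, 0) :: real \<times> real" and ?t = "(m, m + 2)" and ?r = "(m + 2, m + 1)"
  have "real (s ! i) \<in> {1..m}" if "i < length s" for i
    using s that nth_mem[of i s] by (auto simp: is_perm_iff m_def)
  then have P: "fst q < m" "1 \<le> snd q" "snd q \<le> m" if "q \<in> ?P" for q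
    using that by (auto simp: points_def m_def)
  have P_ne: "?P \<noteq> {}"
    using s by (auto simp: is_perm_def points_def)
  have m: "0 \<le> m"
    by (simp add: m_def)
  have gen: "generic ?P"
    using s generic_points by (simp add: is_perm_iff)
  have gen1: "generic (insert ?d ?P)"
    by (rule generic_insert[OF gen]) (use P m in force)+
  have gen2: "generic (insert ?t (insert ?d ?P))"
    by (rule generic_insert[OF gen1]) (use P m in force)+
  have gen3: "generic (insert ?r (insert ?t (insert ?d ?P)))"
    by (rule generic_insert[OF gen2]) (use P m in force)+
  have av1: "avoids (insert ?d ?P)"
  proof (rule avoids_insert_minimal[OF av])
    show "?d \<notin> NE q" if "q \<in> ?P" for q
      using P[OF that] by (auto simp: NE_def)
    show "\<not> emb p {1..<n} (?P \<inter> NE ?d) e" for e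
      using emb_mem[of p "{1..<n}" "?P \<inter> NE ?d" e 1] n P[of "e 1"] by (auto simp: NE_def)
  qed
  have av2: "avoids (insert ?t (insert ?d ?P))"
  proof (rule avoids_insertI[OF av1])
    fix e r
    assume e: "emb p {..<n} (insert ?t (insert ?d ?P)) e" and r: "r < n" "e r = ?t"
      and mem: "\<And>i. i < n \<Longrightarrow> i \<noteq> r \<Longrightarrow> e i \<in> insert ?d ?P"
    \<comment> \<open>As the highest point, \<open>?t\<close> could only be the entry
      \<open>n\<close>; just one point is right of it.\<close>
    have r1: "r = 1"
    proof (rule ccontr)
      assume "r \<noteq> 1"
      then have "m + 2 < snd (e 1)" "e 1 \<in> insert ?d ?P"
        using emb_snd[OF e, of r 1] top[of r] mem[of 1] r n by auto
      then show False
        using P[of "e 1"] m by auto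
    qed
    have "e i = ?d" if "1 < i" "i < n" for i
      using emb_fst[OF e, of 1 i] that r r1 mem[of i] P[of "e i"] by auto
    from this[of 2] this[of 3] show False
      using emb_eq_iff[OF e, of 2 3] n by auto
  qed
  have av3: "avoids (insert ?r (insert ?t (insert ?d ?P)))"
  proof (rule avoids_insertI[OF av2])
    fix e r
    assume e: "emb p {..<n} (insert ?r (insert ?t (insert ?d ?P))) e" and r: "r < n" "e r = ?r"
      and mem: "\<And>i. i < n \<Longrightarrow> i \<noteq> r \<Longrightarrow> e i \<in> insert ?t (insert ?d ?P)"
    \<comment> \<open>As the rightmost point, \<open>?r\<close> could only be the entry 2; just one
      point is above it, too few for the indices 1 and 2.\<close>
    have r1: "r = n - 1"
    proof (rule ccontr)
      assume "r \<noteq> n - 1"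
      then have "m + 2 < fst (e (n - 1))" "e (n - 1) \<in> insert ?t (insert ?d ?P)"
        using emb_fst[OF e, of r "n - 1"] mem[of "n - 1"] r n by auto
      then show False
        using P[of "e (n - 1)"] by auto
    qed
    have "e i = ?t" if "0 < i" "i < n - 1" for i
    proof -
      have "e i \<in> insert ?t (insert ?d ?P)"
        using mem[of i] that r1 by auto
      then show ?thesis
        using emb_snd[OF e, of r i] last[of i] that r r1 P[of "e i"] m by auto
    qed
    from this[of 1] this[of 2] show False
      using emb_eq_iff[OF e, of 1 2] n by auto
  qed
  let ?T = "insert ?r (insert ?t (insert ?d ?P))"
  have "indecomposable fst snd ?T"
    unfolding indecomposable_def
  proof (intro allI impI notI)
    fix U
    assume U: "U \<subseteq> ?T \<and> U \<noteq> {} \<and> U \<noteq> ?T"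
      and ap: "apart fst U (?T - U) \<and> apart snd U (?T - U)"
    then obtain b where b: "\<And>x y. x \<in> ?T \<Longrightarrow> y \<in> ?T \<Longrightarrow> (x \<in> U) \<noteq> (y \<in> U) \<Longrightarrow>
        ((fst x < fst y) \<noteq> (snd x < snd y)) = b"
      using apart_Diff_inversions[of fst U ?T snd] by metis
    \<comment> \<open>The inversions form the path \<open>q\<close>, \<open>?d\<close>,
      \<open>?t\<close>, \<open>?r\<close> and the non-inversions the path \<open>?t\<close>,
      \<open>q\<close>, \<open>?r\<close>, \<open>?d\<close>. Pairs across the cut are all of one
      kind, so the path of the other kind keeps the four points together.\<close>
    have same: "(q \<in> U \<longleftrightarrow> ?d \<in> U) \<and> (?t \<in> U \<longleftrightarrow> ?d \<in> U) \<and> (?r \<in> U \<longleftrightarrow> ?d \<in> U)"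
      if q: "q \<in> ?P" for q
    proof -
      have "\<not> q \<in> U \<longleftrightarrow> ?d \<in> U \<Longrightarrow> b" "\<not> q \<in> U \<longleftrightarrow> ?t \<in> U \<Longrightarrow> \<not> b"
        "\<not> q \<in> U \<longleftrightarrow> ?r \<in> U \<Longrightarrow> \<not> b" "\<not> ?d \<in> U \<longleftrightarrow> ?t \<in> U \<Longrightarrow> b"
        "\<not> ?d \<in> U \<longleftrightarrow> ?r \<in> U \<Longrightarrow> \<not> b" "\<not> ?t \<in> U \<longleftrightarrow> ?r \<in> U \<Longrightarrow> b"
        using b[of q ?d] b[of q ?t] b[of q ?r] b[of ?d ?t] b[of ?d ?r] b[of ?t ?r] q P[OF q] m
        by auto
      then show ?thesis
        by argo
    qed
    obtain q where q: "q \<in> ?P"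
      using P_ne by blast
    have all: "x \<in> U \<longleftrightarrow> ?d \<in> U" if "x \<in> ?T" for x
      using that same[OF q] same[of x] by (elim insertE) simp_all
    show False
    proof (cases "?d \<in> U")
      case True
      have "?T \<subseteq> U"
        by (rule subsetI) (use all True in simp)
      with U[THEN conjunct1] have "U = ?T"
        by (rule subset_antisym)
      then show False
        using U by simp
    next
      case False
      then have "x \<notin> U" for x
        using all[of x] subsetD[OF U[THEN conjunct1]] by metis
      then have "U = {}"
        unfolding eq_iff by (intro conjI subsetI) simp_all
      then show False
        using U by simp
    qed
  qed
  then show ?thesis
    by (intro exI[of _ ?T] conjI gen3 av3) (rule subsetI, simp)
qed

lemma avoider_in_simple_avoider:
  assumes len: "length p = n" and p: "distinct p" and s: "s \<in> Av p"
  shows "\<exists>t\<in>Av p. simple_perm t \<and> contained s t"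
proof -
  have perm: "is_perm s" and not: "\<not> contained p s"
    using s by (auto simp: Av_def)
  then have "avoids (points s)"
    using diagram_contained_iff[OF diagram_points p] by (auto simp: avoids_def len)
  then obtain T where "points s \<subseteq> T" "generic T" "avoids T" "indecomposable fst snd T"
    using ex_indecomposable_extension[OF perm] by blast
  then obtain T where T: "points s \<subseteq> T" "generic T" "avoids T" "proper_blocks fst snd T = {}"
    using ex_simple_extension[of T] by (meson order_trans)
  moreover have "points s \<noteq> {}"
    using perm by (auto simp: is_perm_def points_def)
  ultimately obtain t \<phi> where t: "is_perm t" "diagram t T \<phi>"
    using ex_diagram[of T] by blast
  have "\<not> contained p t"
    using diagram_contained_iff[OF t(2) p] T(3) by (simp add: avoids_def len)
  moreover have "contained s t"
    using diagram_contained_iff[OF t(2)] diagram_emb[OF diagram_points T(1)] perm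
    by (auto simp: is_perm_iff)
  ultimately show ?thesis
    using t(1) diagram_simple[OF t T(4)] by (auto simp: Av_def)
qed

end

section \<open>From simple extensions to non-deflatability\<close>

text \<open>The closure of \<open>D\<close> has no simple permutations besides those of
  \<open>D\<close>, so \<open>t\<close> lies in \<open>D\<close>, and \<open>s\<close> follows
  because \<open>D\<close> is a class. Thus \<open>D\<close> cannot be proper.\<close>

lemma not_deflatableI:
  assumes "\<And>s. s \<in> C \<Longrightarrow> \<exists>t\<in>C. simple_perm t \<and> contained s t" "\<forall>s\<in>C. is_perm s"
  shows "\<not> deflatable C"
proof
  assume "deflatable C"
  then obtain D where D: "perm_class D" "D \<subset> C" "C \<subseteq> substitution_closure D"
    unfolding deflatable_def by blast
  have "C \<subseteq> D"
  proof
    fix s assume s: "s \<in> C"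
    then obtain t where t: "t \<in> C" "simple_perm t" "contained s t"
      using assms(1)[OF s] by blast
    have "t \<in> simples (substitution_closure D)"
      using subsetD[OF D(3) t(1)] t(2) by (simp add: simples_def)
    then have "t \<in> D"
      unfolding simples_substitution_closure[OF D(1)] by (simp add: simples_def)
    moreover have "is_perm s"
      using assms(2) s by blast
    ultimately show "s \<in> D"
      using D(1) t(3) unfolding perm_class_def by blast
  qed
  then show False
    using D(2) by blast
qed

theorem theorem3p7:
  fixes \<pi> :: "nat list" and n :: nat
  assumes "is_perm \<pi>"
    and "length \<pi> = n"
    and "n \<ge> 3"
    and "\<pi> ! 0 = 1"
    and "\<pi> ! 1 = n"
    and "\<pi> ! (n - 1) = 2"
    and "\<not> (\<exists>i. decreasing_bond \<pi> i)"
  shows "\<not> deflatable (Av \<pi>)"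
proof -
  have dist: "distinct \<pi>" and set: "set \<pi> = {1..n}"
    using assms(1,2) by (auto simp: is_perm_iff)
  have range: "1 \<le> \<pi> ! i" "\<pi> ! i \<le> n" if "i < n" for i
    using nth_mem[of i \<pi>] that assms(2) set by auto
  have inj: "\<pi> ! i = \<pi> ! j \<longleftrightarrow> i = j" if "i < n" "j < n" for i j
    using nth_eq_iff_index_eq[OF dist] that assms(2) by auto
  have bond: "\<pi> ! i \<noteq> Suc (\<pi> ! Suc i)" if "Suc i < n" for i
    using assms(2,7) that by (auto simp: decreasing_bond_def bond_def)
  \<comment> \<open>For length 3 the pattern is 132, with the bond 32. For length 4 the remaining
    entry is 3, which gives 1432 with the bond 43.\<close>
  have "n \<noteq> 3"
    using bond[of 1] assms(5,6) by (auto simp: numeral_eq_Suc)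
  moreover have "n \<noteq> 4"
  proof
    assume n: "n = 4"
    have "\<pi> ! 2 \<noteq> 1" "\<pi> ! 2 \<noteq> 2" "\<pi> ! 2 \<noteq> 4"
      using inj[of 2 0] inj[of 2 3] inj[of 2 1] assms(4,5,6) n by auto
    then have "\<pi> ! 2 = 3"
      using range[of 2] n by auto
    then show False
      using bond[of 1] assms(5) n by (auto simp: numeral_eq_Suc)
  qed
  ultimately have n: "5 \<le> n"
    using assms(3) by linarith
  interpret pattern \<pi> n
  proof
    show "\<pi> ! 0 < \<pi> ! i" if "0 < i" "i < n" for i
      using range[of i] inj[of i 0] that assms(4) by fastforce
    show "\<pi> ! i < \<pi> ! 1" if "i < n" "i \<noteq> 1" for i
      using range[of i] inj[of i 1] that assms(3,5) by fastforce
    show "\<pi> ! (n - 1) < \<pi> ! i" if "0 < i" "i < n - 1" for i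
      using range[of i] inj[of i 0] inj[of i "n - 1"] that assms(4,6) by fastforce
  qed (fact n)
  show ?thesis
    by (rule not_deflatableI) (use avoider_in_simple_avoider[OF assms(2) dist] in \<open>auto simp: Av_def\<close>)
qed

end
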